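(* For every integer $m\ge 0$, the border rank of the tensor $$T_{HW,m}=6a_1a_2b_0+3a_1^2b_1+3a_2^2b_2+6\sum_{j=1}^{m}(a_1x_jy_j+a_2x_jz_j)\in S^3(V)\subseteq V\otimes V\otimes V$$ is equal to $3m+5$, where $V$ is the $(3m+5)$-dimensional complex vector space with basis $\{a_1,a_2,x_1,\ldots,x_m,y_1,\ldots,y_m,z_1,\ldots,z_m,b_0,b_1,b_2\}$.
   Context: For elements $x,y,z$ of a vector space $V$, the product $xyz$ denotes the symmetric tensor $\frac16(x\otimes y\otimes z+x\otimes z\otimes y+y\otimes x\otimes z+y\otimes z\otimes x+z\otimes x\otimes y+z\otimes y\otimes x)\in V\otimes V\otimes V$. The border rank of a tensor $T\in V\otimes V\otimes V$ is the least $r$ such that $T$ is a limit of tensors of rank at most $r$ (the rank being the least number of summands $u\otimes v\otimes w$ in an expression of the tensor). *)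

theory Defs
  imports Complex_Main
begin

text \<open>For a finite set \<^term>\<open>I\<close> of basis labels, the complex vector space with basis \<^term>\<open>I\<close> is
  the space of functions supported on \<^term>\<open>I\<close>, and its third tensor power is the space of
  coordinate arrays supported on \<open>I \<times> I \<times> I\<close>.\<close>

definition vec_space :: "'i set \<Rightarrow> ('i \<Rightarrow> complex) set" where
  "vec_space I = {v. \<forall>i. i \<notin> I \<longrightarrow> v i = 0}"

type_synonym 'i tensor3 = "'i \<Rightarrow> 'i \<Rightarrow> 'i \<Rightarrow> complex"

definition tensor_space :: "'i set \<Rightarrow> 'i tensor3 set" where
  "tensor_space I = {T. \<forall>i j k. \<not> (i \<in> I \<and> j \<in> I \<and> k \<in> I) \<longrightarrow> T i j k = 0}"

definition basis_vec :: "'i \<Rightarrow> 'i \<Rightarrow> complex" where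
  "basis_vec i = (\<lambda>j. if j = i then 1 else 0)"

definition tensor_prod :: "('i \<Rightarrow> complex) \<Rightarrow> ('i \<Rightarrow> complex) \<Rightarrow> ('i \<Rightarrow> complex) \<Rightarrow> 'i tensor3" where
  "tensor_prod u v w = (\<lambda>i j k. u i * v j * w k)"

definition sym_prod :: "('i \<Rightarrow> complex) \<Rightarrow> ('i \<Rightarrow> complex) \<Rightarrow> ('i \<Rightarrow> complex) \<Rightarrow> 'i tensor3" where
  "sym_prod x y z = (\<lambda>i j k. 1/6 *
     (tensor_prod x y z i j k + tensor_prod x z y i j k + tensor_prod y x z i j k
      + tensor_prod y z x i j k + tensor_prod z x y i j k + tensor_prod z y x i j k))"

definition is_sum_of_products :: "'i set \<Rightarrow> 'i tensor3 \<Rightarrow> nat \<Rightarrow> bool" where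
  "is_sum_of_products I T r \<longleftrightarrow>
     (\<exists>u v w. (\<forall>l<r. u l \<in> vec_space I \<and> v l \<in> vec_space I \<and> w l \<in> vec_space I) \<and>
        T = (\<lambda>i j k. \<Sum>l<r. tensor_prod (u l) (v l) (w l) i j k))"

definition tensor_rank :: "'i set \<Rightarrow> 'i tensor3 \<Rightarrow> nat" where
  "tensor_rank I T = (LEAST r. is_sum_of_products I T r)"

text \<open>Convergence in the finite-dimensional space \<^term>\<open>tensor_space I\<close> is convergence of all
  coordinates.\<close>

definition is_limit_of_rank_le :: "'i set \<Rightarrow> 'i tensor3 \<Rightarrow> nat \<Rightarrow> bool" where
  "is_limit_of_rank_le I T r \<longleftrightarrow>
     (\<exists>S :: nat \<Rightarrow> 'i tensor3.
        (\<forall>n. S n \<in> tensor_space I \<and> tensor_rank I (S n) \<le> r) \<and>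
        (\<forall>i j k. (\<lambda>n. S n i j k) \<longlonglongrightarrow> T i j k))"

definition border_rank :: "'i set \<Rightarrow> 'i tensor3 \<Rightarrow> nat" where
  "border_rank I T = (LEAST r. is_limit_of_rank_le I T r)"

datatype hw_label = A1 | A2 | Xj nat | Yj nat | Zj nat | B0 | B1 | B2

definition hw_basis :: "nat \<Rightarrow> hw_label set" where
  "hw_basis m = {A1, A2} \<union> Xj ` {1..m} \<union> Yj ` {1..m} \<union> Zj ` {1..m} \<union> {B0, B1, B2}"

definition T_HW :: "nat \<Rightarrow> hw_label tensor3" where
  "T_HW m =
    (let a1 = basis_vec A1; a2 = basis_vec A2;
         x = (\<lambda>j. basis_vec (Xj j)); y = (\<lambda>j. basis_vec (Yj j)); z = (\<lambda>j. basis_vec (Zj j));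
         b0 = basis_vec B0; b1 = basis_vec B1; b2 = basis_vec B2
     in (\<lambda>p q r. 6 * sym_prod a1 a2 b0 p q r + 3 * sym_prod a1 a1 b1 p q r
           + 3 * sym_prod a2 a2 b2 p q r
           + 6 * (\<Sum>j=1..m. sym_prod a1 (x j) (y j) p q r + sym_prod a2 (x j) (z j) p q r)))"

lemma finite_hw_basis: "finite (hw_basis m)"
  by (simp add: hw_basis_def)

lemma card_hw_basis: "card (hw_basis m) = 3 * m + 5"
proof -
  have c: "card (Xj ` {1..m}) = m" "card (Yj ` {1..m}) = m" "card (Zj ` {1..m}) = m"
    by (simp_all add: card_image inj_on_def)
  have "card (Xj ` {1..m} \<union> (Yj ` {1..m} \<union> Zj ` {1..m})) = 3 * m"
    by (subst card_Un_disjoint; (subst card_Un_disjoint)?) (auto simp: c simp del: One_nat_def)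
  moreover have "hw_basis m =
      insert A1 (insert A2 (insert B0 (insert B1 (insert B2
        (Xj ` {1..m} \<union> (Yj ` {1..m} \<union> Zj ` {1..m}))))))"
    by (auto simp: hw_basis_def)
  ultimately show ?thesis
    by (simp add: image_iff)
qed

lemma T_HW_in_tensor_space: "T_HW m \<in> tensor_space (hw_basis m)"
proof -
  have s: "sym_prod (basis_vec a) (basis_vec b) (basis_vec c) i j k = 0"
    if "a \<in> I" "b \<in> I" "c \<in> I" "\<not> (i \<in> I \<and> j \<in> I \<and> k \<in> I)" for a b c i j k and I :: "hw_label set"
    using that by (auto simp: sym_prod_def tensor_prod_def basis_vec_def)
  have m: "A1 \<in> hw_basis m" "A2 \<in> hw_basis m" "B0 \<in> hw_basis m" "B1 \<in> hw_basis m" "B2 \<in> hw_basis m"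
    by (auto simp: hw_basis_def)
  have n: "Xj j \<in> hw_basis m" "Yj j \<in> hw_basis m" "Zj j \<in> hw_basis m" if "j \<in> {1..m}" for j
    using that by (auto simp: hw_basis_def)
  show ?thesis
    unfolding tensor_space_def T_HW_def Let_def
    by (auto simp: s[where I = "hw_basis m"] m n intro!: sum.neutral)
qed

lemma T_HW_symmetric: "T_HW m i j k = T_HW m j i k" "T_HW m i j k = T_HW m i k j"
  by (simp_all add: T_HW_def sym_prod_def tensor_prod_def Let_def algebra_simps)

text \<open>The minima defining rank and border rank range over nonempty sets.\<close>

lemma ex_is_sum_of_products:
  assumes "finite I" and T: "T \<in> tensor_space I"
  shows "\<exists>r. is_sum_of_products I T r"
proof -
  let ?P = "I \<times> I \<times> I"
  have fin: "finite ?P" using assms by simp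
  obtain h where h: "bij_betw h {..<card ?P} ?P"
    using ex_bij_betw_nat_finite[OF fin] by (auto simp: atLeast0LessThan)
  define u where "u p = (case p of (a, b, c) \<Rightarrow> (\<lambda>i. T a b c * basis_vec a i))" for p
  define v where "v p = (case p of (a, b, c) \<Rightarrow> basis_vec b)" for p :: "'a \<times> 'a \<times> 'a"
  define w where "w p = (case p of (a, b, c) \<Rightarrow> basis_vec c)" for p :: "'a \<times> 'a \<times> 'a"
  have "T i j k = (\<Sum>l<card ?P. tensor_prod (u (h l)) (v (h l)) (w (h l)) i j k)" for i j k
  proof -
    have "(\<Sum>l<card ?P. tensor_prod (u (h l)) (v (h l)) (w (h l)) i j k)
        = (\<Sum>p\<in>?P. tensor_prod (u p) (v p) (w p) i j k)"
      using sum.reindex_bij_betw[OF h, of "\<lambda>p. tensor_prod (u p) (v p) (w p) i j k"] .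
    also have "\<dots> = (\<Sum>p\<in>?P. if p = (i, j, k) then T i j k else 0)"
      by (rule sum.cong) (auto simp: u_def v_def w_def tensor_prod_def basis_vec_def split: if_splits)
    also have "\<dots> = T i j k"
      using T fin by (auto simp: tensor_space_def)
    finally show ?thesis by simp
  qed
  then have eq: "T = (\<lambda>i j k. \<Sum>l<card ?P. tensor_prod (u (h l)) (v (h l)) (w (h l)) i j k)"
    by (intro ext)
  have "u (h l) \<in> vec_space I \<and> v (h l) \<in> vec_space I \<and> w (h l) \<in> vec_space I"
    if "l < card ?P" for l
  proof -
    have "h l \<in> ?P" using h that by (auto simp: bij_betw_def)
    then show ?thesis
      by (auto simp: u_def v_def w_def vec_space_def basis_vec_def)
  qed
  then have mem: "\<forall>l<card ?P. u (h l) \<in> vec_space I \<and> v (h l) \<in> vec_space I \<and> w (h l) \<in> vec_space I"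
    by blast
  have "is_sum_of_products I T (card ?P)"
    unfolding is_sum_of_products_def
    apply (rule exI[of _ "\<lambda>l. u (h l)"], rule exI[of _ "\<lambda>l. v (h l)"], rule exI[of _ "\<lambda>l. w (h l)"])
    by (rule conjI[OF mem eq])
  then show ?thesis ..
qed

lemma is_limit_of_rank_le_tensor_rank:
  assumes "T \<in> tensor_space I"
  shows "is_limit_of_rank_le I T (tensor_rank I T)"
  unfolding is_limit_of_rank_le_def using assms by (intro exI[of _ "\<lambda>_. T"]) auto

end

theory Submission
  imports Defs "HOL-Library.Function_Algebras" "Jordan_Normal_Form.Determinant"
begin

text \<open>
  Lower bound: each basis vector is singled out by one column of the flattening of \<open>T_HW m\<close>, so
  that the flattening has a minor of size \<open>3m + 5\<close> equal to 1. Minors depend continuously on the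
  tensor, and those of size greater than \<open>r\<close> vanish on sums of \<open>r\<close> products.

  Upper bound: estimate the border rank simultaneously for all tensors in \<open>T + W\<close>, where \<open>W\<close> is
  the space of sums \<open>\<Sum> q\<^sub>k\<^sup>2 e\<^sub>k\<close> over the five points \<open>q\<^sub>k = a\<^sub>1 + k a\<^sub>2\<close>, \<open>-2 \<le> k \<le> 2\<close>.
  For \<open>T = 0\<close> it is at most 5: perturb the cubes in the linear relation \<open>\<Sum> c\<^sub>k q\<^sub>k\<^sup>3 = 0\<close>.
  Adding a term \<open>l\<^sup>2 q\<^sub>k\<close> costs only one cube \<open>(q\<^sub>k + t l)\<^sup>3\<close>, whose lower order terms \<open>q\<^sub>k\<^sup>3\<close>
  and \<open>q\<^sub>k\<^sup>2 l\<close> are absorbed in \<open>W\<close>. Finally \<open>a\<^sub>1 x y + a\<^sub>2 x z\<close> is a limit of combinations of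
  three terms \<open>l\<^sup>2 q\<close> with \<open>q = a\<^sub>1, a\<^sub>1 + a\<^sub>2, a\<^sub>1 - a\<^sub>2\<close>: the tangent vectors to the squares \<open>x\<^sup>2\<close>
  can be chosen freely once \<open>(a\<^sub>1 + a\<^sub>2) + (a\<^sub>1 - a\<^sub>2) - 2 a\<^sub>1 = 0\<close> removes the leading term.
\<close>

section \<open>Sums of products and their limits\<close>

lemma sum_fun_apply: "(\<Sum>k\<in>K. f k) x = (\<Sum>k\<in>K. f k x)"
  by (induction K rule: infinite_finite_induct) auto

lemma is_sum_of_products_tensor_prod:
  assumes "u \<in> vec_space I" "v \<in> vec_space I" "w \<in> vec_space I"
  shows "is_sum_of_products I (tensor_prod u v w) 1"
  unfolding is_sum_of_products_def
  using assms by (intro exI[of _ "\<lambda>_. u"] exI[of _ "\<lambda>_. v"] exI[of _ "\<lambda>_. w"]) auto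

lemma is_sum_of_products_zero: "is_sum_of_products I 0 r"
  unfolding is_sum_of_products_def
  by (intro exI[of _ "\<lambda>_ _. 0"]) (auto simp: vec_space_def tensor_prod_def zero_fun_def)

lemma is_sum_of_products_add:
  assumes "is_sum_of_products I S r" "is_sum_of_products I T s"
  shows "is_sum_of_products I (S + T) (r + s)"
proof -
  obtain u v w where S: "\<forall>l<r. u l \<in> vec_space I \<and> v l \<in> vec_space I \<and> w l \<in> vec_space I"
    "S = (\<lambda>i j k. \<Sum>l<r. tensor_prod (u l) (v l) (w l) i j k)"
    using assms(1) unfolding is_sum_of_products_def by blast
  obtain u' v' w' where T: "\<forall>l<s. u' l \<in> vec_space I \<and> v' l \<in> vec_space I \<and> w' l \<in> vec_space I"
    "T = (\<lambda>i j k. \<Sum>l<s. tensor_prod (u' l) (v' l) (w' l) i j k)"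
    using assms(2) unfolding is_sum_of_products_def by blast
  define append where "append f g l = (if l < r then f l else g (l - r))"
    for f g :: "nat \<Rightarrow> 'a \<Rightarrow> complex" and l
  have split: "(\<Sum>l<r + s. h l) = (\<Sum>l<r. h l) + (\<Sum>l<s. h (r + l))" for h :: "nat \<Rightarrow> complex"
    by (induction s) (simp_all add: add.assoc)
  have "\<forall>l<r + s. append u u' l \<in> vec_space I \<and> append v v' l \<in> vec_space I
      \<and> append w w' l \<in> vec_space I"
    using S(1) T(1) by (auto simp: append_def)
  moreover have "S + T =
      (\<lambda>i j k. \<Sum>l<r + s. tensor_prod (append u u' l) (append v v' l) (append w w' l) i j k)"
    unfolding split by (intro ext) (simp add: append_def S(2) T(2))
  ultimately show ?thesis
    unfolding is_sum_of_products_def by blast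
qed

lemma is_sum_of_products_sum:
  assumes "\<And>k. k \<in> K \<Longrightarrow> is_sum_of_products I (T k) (r k)"
  shows "is_sum_of_products I (\<Sum>k\<in>K. T k) (\<Sum>k\<in>K. r k)"
  using assms
  by (induction K rule: infinite_finite_induct)
    (auto intro: is_sum_of_products_zero is_sum_of_products_add)

lemma is_sum_of_products_mono:
  assumes "is_sum_of_products I T r" "r \<le> s"
  shows "is_sum_of_products I T s"
  using is_sum_of_products_add[OF assms(1) is_sum_of_products_zero, of "s - r"] assms(2) by simp

lemma is_sum_of_products_in_tensor_space:
  assumes "is_sum_of_products I T r"
  shows "T \<in> tensor_space I"
  using assms unfolding is_sum_of_products_def tensor_space_def vec_space_def tensor_prod_def
  by (auto intro!: sum.neutral)

lemma tensor_rank_le_iff: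
  assumes "finite I" "T \<in> tensor_space I"
  shows "tensor_rank I T \<le> r \<longleftrightarrow> is_sum_of_products I T r"
proof
  have "is_sum_of_products I T (tensor_rank I T)"
    unfolding tensor_rank_def by (rule LeastI_ex[OF ex_is_sum_of_products[OF assms]])
  then show "is_sum_of_products I T r" if "tensor_rank I T \<le> r"
    using that by (rule is_sum_of_products_mono)
  show "tensor_rank I T \<le> r" if "is_sum_of_products I T r"
    unfolding tensor_rank_def using that by (rule Least_le)
qed

lemma is_limit_of_rank_le_iff:
  assumes "finite I"
  shows "is_limit_of_rank_le I T r \<longleftrightarrow>
    (\<exists>S. (\<forall>n. is_sum_of_products I (S n) r) \<and> (\<forall>i j k. (\<lambda>n. S n i j k) \<longlonglongrightarrow> T i j k))"
proof -
  have "S \<in> tensor_space I \<and> tensor_rank I S \<le> r \<longleftrightarrow> is_sum_of_products I S r" for S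
    using tensor_rank_le_iff[OF assms] is_sum_of_products_in_tensor_space by blast
  then show ?thesis
    by (simp add: is_limit_of_rank_le_def)
qed

lemma is_limit_of_rank_le_if_is_sum_of_products:
  assumes "finite I" "is_sum_of_products I T r"
  shows "is_limit_of_rank_le I T r"
  unfolding is_limit_of_rank_le_iff[OF assms(1)] using assms(2) by (intro exI[of _ "\<lambda>_. T"]) auto

lemma is_limit_of_rank_le_add:
  assumes "finite I" "is_limit_of_rank_le I S r" "is_limit_of_rank_le I T s"
  shows "is_limit_of_rank_le I (S + T) (r + s)"
proof -
  obtain P Q where
    "\<And>n. is_sum_of_products I (P n) r" "\<And>i j k. (\<lambda>n. P n i j k) \<longlonglongrightarrow> S i j k"
    "\<And>n. is_sum_of_products I (Q n) s" "\<And>i j k. (\<lambda>n. Q n i j k) \<longlonglongrightarrow> T i j k"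
    using assms(2,3) unfolding is_limit_of_rank_le_iff[OF assms(1)] by blast
  then show ?thesis
    unfolding is_limit_of_rank_le_iff[OF assms(1)]
    by (intro exI[of _ "\<lambda>n. P n + Q n"]) (auto intro: is_sum_of_products_add tendsto_add)
qed

lemma tensor_space_tendsto:
  assumes "F \<noteq> bot" "\<forall>\<^sub>F t in F. S t \<in> tensor_space I"
    and lim: "\<And>i j k. ((\<lambda>t. S t i j k) \<longlongrightarrow> T i j k) F"
  shows "T \<in> tensor_space I"
  unfolding tensor_space_def
proof (intro CollectI allI impI)
  fix i j k assume "\<not> (i \<in> I \<and> j \<in> I \<and> k \<in> I)"
  then have "\<forall>\<^sub>F t in F. S t i j k = 0"
    using assms(2) by (auto simp: tensor_space_def elim: eventually_mono)
  then have "((\<lambda>t. S t i j k) \<longlongrightarrow> 0) F"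
    by (rule tendsto_eventually)
  then show "T i j k = 0"
    using \<open>F \<noteq> bot\<close> lim tendsto_unique by blast
qed

lemma is_limit_of_rank_le_in_tensor_space:
  assumes "is_limit_of_rank_le I T r"
  shows "T \<in> tensor_space I"
proof -
  obtain S where "\<And>n. S n \<in> tensor_space I" "\<And>i j k. (\<lambda>n. S n i j k) \<longlonglongrightarrow> T i j k"
    using assms unfolding is_limit_of_rank_le_def by blast
  then show ?thesis
    by (intro tensor_space_tendsto[OF sequentially_bot always_eventually]) auto
qed

lemma eventually_uniformly_close:
  assumes "finite I" "F \<noteq> bot" and S: "\<forall>\<^sub>F t in F. S t \<in> tensor_space I"
    and lim: "\<And>i j k. ((\<lambda>t. S t i j k) \<longlongrightarrow> T i j k) F" and "\<epsilon> > 0"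
  shows "\<forall>\<^sub>F t in F. \<forall>i j k. dist (S t i j k) (T i j k) < \<epsilon>"
proof -
  have "\<forall>\<^sub>F t in F. \<forall>i\<in>I. \<forall>j\<in>I. \<forall>k\<in>I. dist (S t i j k) (T i j k) < \<epsilon>"
    using \<open>finite I\<close> by (intro eventually_ball_finite ballI tendstoD[OF lim \<open>\<epsilon> > 0\<close>])
  with S show ?thesis
  proof eventually_elim
    case (elim t)
    have "T \<in> tensor_space I"
      using \<open>F \<noteq> bot\<close> S lim by (rule tensor_space_tendsto)
    show ?case
    proof (intro allI)
      fix i j k
      show "dist (S t i j k) (T i j k) < \<epsilon>"
        using elim \<open>T \<in> tensor_space I\<close> \<open>\<epsilon> > 0\<close>
        by (cases "i \<in> I \<and> j \<in> I \<and> k \<in> I") (auto simp: tensor_space_def)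
    qed
  qed
qed

lemma is_limit_of_rank_le_iff_approximable:
  assumes "finite I"
  shows "is_limit_of_rank_le I T r \<longleftrightarrow>
    (\<forall>\<epsilon>>0. \<exists>S. is_sum_of_products I S r \<and> (\<forall>i j k. dist (S i j k) (T i j k) < \<epsilon>))"
proof
  assume "is_limit_of_rank_le I T r"
  then obtain S where S: "\<And>n. is_sum_of_products I (S n) r"
    and lim: "\<And>i j k. (\<lambda>n. S n i j k) \<longlonglongrightarrow> T i j k"
    unfolding is_limit_of_rank_le_iff[OF assms] by blast
  show "\<forall>\<epsilon>>0. \<exists>S. is_sum_of_products I S r \<and> (\<forall>i j k. dist (S i j k) (T i j k) < \<epsilon>)"
  proof (intro allI impI)
    fix \<epsilon> :: real assume "\<epsilon> > 0"
    have "\<forall>\<^sub>F n in sequentially. \<forall>i j k. dist (S n i j k) (T i j k) < \<epsilon>"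
      using assms sequentially_bot _ lim \<open>\<epsilon> > 0\<close>
    proof (rule eventually_uniformly_close)
      show "\<forall>\<^sub>F n in sequentially. S n \<in> tensor_space I"
        using S by (intro always_eventually) (blast intro: is_sum_of_products_in_tensor_space)
    qed
    then obtain n where "\<forall>i j k. dist (S n i j k) (T i j k) < \<epsilon>"
      using eventually_happens'[OF sequentially_bot] by blast
    then show "\<exists>S. is_sum_of_products I S r \<and> (\<forall>i j k. dist (S i j k) (T i j k) < \<epsilon>)"
      using S by blast
  qed
next
  assume approximable:
    "\<forall>\<epsilon>>0. \<exists>S. is_sum_of_products I S r \<and> (\<forall>i j k. dist (S i j k) (T i j k) < \<epsilon>)"
  have "\<exists>S. is_sum_of_products I S r \<and>
      (\<forall>i j k. dist (S i j k) (T i j k) < inverse (real (Suc n)))" for n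
    by (rule approximable[rule_format]) simp
  then obtain S where S: "\<And>n. is_sum_of_products I (S n) r"
    and close: "\<And>n i j k. dist (S n i j k) (T i j k) < inverse (real (Suc n))"
    by metis
  have "(\<lambda>n. S n i j k) \<longlonglongrightarrow> T i j k" for i j k
  proof (rule metric_tendsto_imp_tendsto[OF LIMSEQ_inverse_real_of_nat])
    show "\<forall>\<^sub>F n in sequentially. dist (S n i j k) (T i j k) \<le> dist (inverse (real (Suc n))) 0"
      using close[THEN less_imp_le]
      by (intro always_eventually) (simp add: dist_real_def del: of_nat_Suc)
  qed
  then show "is_limit_of_rank_le I T r"
    unfolding is_limit_of_rank_le_iff[OF assms] using S by blast
qed

lemma is_limit_of_rank_le_tendsto:
  assumes "finite I" "F \<noteq> bot" and S: "\<forall>\<^sub>F t in F. is_limit_of_rank_le I (S t) r"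
    and lim: "\<And>i j k. ((\<lambda>t. S t i j k) \<longlongrightarrow> T i j k) F"
  shows "is_limit_of_rank_le I T r"
  unfolding is_limit_of_rank_le_iff_approximable[OF \<open>finite I\<close>]
proof (intro allI impI)
  fix \<epsilon> :: real assume "\<epsilon> > 0"
  have "\<forall>\<^sub>F t in F. \<forall>i j k. dist (S t i j k) (T i j k) < \<epsilon> / 2"
    using S \<open>\<epsilon> > 0\<close>
    by (intro eventually_uniformly_close[OF assms(1,2)] lim)
      (auto elim: eventually_mono intro: is_limit_of_rank_le_in_tensor_space)
  then have "\<forall>\<^sub>F t in F. is_limit_of_rank_le I (S t) r \<and>
      (\<forall>i j k. dist (S t i j k) (T i j k) < \<epsilon> / 2)"
    using S by eventually_elim blast
  then obtain t where "is_limit_of_rank_le I (S t) r"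
    and t: "\<And>i j k. dist (S t i j k) (T i j k) < \<epsilon> / 2"
    using eventually_happens'[OF \<open>F \<noteq> bot\<close>] by blast
  then obtain R where "is_sum_of_products I R r" "\<And>i j k. dist (R i j k) (S t i j k) < \<epsilon> / 2"
    unfolding is_limit_of_rank_le_iff_approximable[OF \<open>finite I\<close>]
    using \<open>\<epsilon> > 0\<close> half_gt_zero by blast
  moreover from this(2) t have "dist (R i j k) (T i j k) < \<epsilon>" for i j k
    by (rule dist_triangle_half_r[OF dist_commute_lessI])
  ultimately show "\<exists>R. is_sum_of_products I R r \<and> (\<forall>i j k. dist (R i j k) (T i j k) < \<epsilon>)"
    by blast
qed

lemma is_limit_of_rank_le_curve:
  fixes C :: "complex \<Rightarrow> 'i tensor3"
  assumes "finite I" "\<And>t. t \<noteq> 0 \<Longrightarrow> is_limit_of_rank_le I (C t) r"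
    and "\<And>x y z. isCont (\<lambda>t. C t x y z) 0"
  shows "is_limit_of_rank_le I (C 0) r"
proof (rule is_limit_of_rank_le_tendsto[where F = "at 0"])
  show "\<forall>\<^sub>F t in at 0. is_limit_of_rank_le I (C t) r"
    using assms(2) by (auto simp: eventually_at_filter)
qed (use assms(1,3) in \<open>auto simp: isCont_def\<close>)

section \<open>Flattenings and the lower bound\<close>

lemma tendsto_det:
  fixes M :: "'t \<Rightarrow> nat \<times> nat \<Rightarrow> 'a :: real_normed_field"
  assumes "\<And>a b. a < n \<Longrightarrow> b < n \<Longrightarrow> ((\<lambda>t. M t (a, b)) \<longlongrightarrow> N (a, b)) F"
  shows "((\<lambda>t. det (mat n n (M t))) \<longlongrightarrow> det (mat n n N)) F"
proof -
  have det: "det (mat n n L) = (\<Sum>p | p permutes {0..<n}. signof p * (\<Prod>i = 0..<n. L (i, p i)))"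
    for L :: "nat \<times> nat \<Rightarrow> 'a"
    unfolding det_def'[OF mat_carrier]
    by (intro sum.cong refl arg_cong2[where f = "(*)"] prod.cong) auto
  show ?thesis
    unfolding det
    by (intro tendsto_sum tendsto_mult tendsto_const tendsto_prod assms) auto
qed

lemma det_inner_dim_less:
  fixes X Y :: "nat \<Rightarrow> nat \<Rightarrow> 'a :: idom"
  assumes "r < n"
  shows "det (mat n n (\<lambda>(a, b). \<Sum>l<r. X a l * Y l b)) = 0"
proof -
  define A where "A = mat n n (\<lambda>(a, l). if l < r then X a l else 0)"
  define B where "B = mat\<^sub>r n n (\<lambda>l. if l = r then 0\<^sub>v n else vec n (Y l))"
  have "(\<Sum>l = 0..<n. A $$ (a, l) * B $$ (l, b)) = (\<Sum>l<r. X a l * Y l b)"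
    if "a < n" "b < n" for a b
    using assms that by (intro sum.mono_neutral_cong_right) (auto simp: A_def B_def)
  then have "mat n n (\<lambda>(a, b). \<Sum>l<r. X a l * Y l b) = A * B"
    by (intro eq_matI) (auto simp: A_def B_def scalar_prod_def)
  moreover have "det B = 0"
    unfolding B_def using assms by (intro det_row_0) auto
  moreover have "det (A * B) = det A * det B"
    by (rule det_mult[of _ n]) (auto simp: A_def B_def)
  ultimately show ?thesis by simp
qed

definition flattening :: "'i tensor3 \<Rightarrow> 'i \<Rightarrow> 'i \<times> 'i \<Rightarrow> complex" where
  "flattening T i = (\<lambda>(j, k). T i j k)"

definition flattening_minor :: "'i tensor3 \<Rightarrow> nat \<Rightarrow> (nat \<Rightarrow> 'i) \<Rightarrow> (nat \<Rightarrow> 'i \<times> 'i) \<Rightarrow> complex" where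
  "flattening_minor T n \<rho> \<kappa> = det (mat n n (\<lambda>(a, b). flattening T (\<rho> a) (\<kappa> b)))"

lemma flattening_minor_eq_0:
  assumes "is_sum_of_products I T r" "r < n"
  shows "flattening_minor T n \<rho> \<kappa> = 0"
proof -
  obtain u v w where "T = (\<lambda>i j k. \<Sum>l<r. tensor_prod (u l) (v l) (w l) i j k)"
    using assms(1) unfolding is_sum_of_products_def by blast
  then have "flattening T i jk = (\<Sum>l<r. u l i * (v l (fst jk) * w l (snd jk)))" for i jk
    by (simp add: flattening_def tensor_prod_def mult.assoc case_prod_beta)
  then show ?thesis
    unfolding flattening_minor_def by (simp add: det_inner_dim_less[OF assms(2)])
qed

lemma is_limit_of_rank_le_imp_flattening_minor_eq_0:
  assumes "finite I" "is_limit_of_rank_le I T r" "r < n"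
  shows "flattening_minor T n \<rho> \<kappa> = 0"
proof -
  obtain S where S: "\<And>m. is_sum_of_products I (S m) r"
    and lim: "\<And>i j k. (\<lambda>m. S m i j k) \<longlonglongrightarrow> T i j k"
    using assms(2) unfolding is_limit_of_rank_le_iff[OF assms(1)] by blast
  have "(\<lambda>m. flattening_minor (S m) n \<rho> \<kappa>) \<longlonglongrightarrow> flattening_minor T n \<rho> \<kappa>"
    unfolding flattening_minor_def
    by (rule tendsto_det) (simp add: flattening_def case_prod_beta lim)
  moreover have "flattening_minor (S m) n \<rho> \<kappa> = 0" for m
    by (rule flattening_minor_eq_0[OF S assms(3)])
  ultimately show ?thesis
    by (simp add: LIMSEQ_const_iff)
qed

lemma card_le_if_flattening_contains_identity:
  assumes "finite I" "is_limit_of_rank_le I T r"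
    and identity: "\<And>i p. i \<in> I \<Longrightarrow> p \<in> I \<Longrightarrow> flattening T i (f p) = of_bool (i = p)"
  shows "card I \<le> r"
proof (rule ccontr)
  assume "\<not> card I \<le> r"
  obtain h where h: "bij_betw h {0..<card I} I"
    using ex_bij_betw_nat_finite[OF assms(1)] by blast
  have "h a \<in> I" "h a = h b \<longleftrightarrow> a = b" if "a < card I" "b < card I" for a b
    using h that by (auto simp: bij_betw_def inj_on_def)
  then have "mat (card I) (card I) (\<lambda>(a, b). flattening T (h a) (f (h b))) = 1\<^sub>m (card I)"
    by (intro eq_matI) (auto simp: identity)
  then have "flattening_minor T (card I) h (f \<circ> h) = 1"
    by (simp add: flattening_minor_def)
  moreover have "flattening_minor T (card I) h (f \<circ> h) = 0"
    using assms(1,2) \<open>\<not> card I \<le> r\<close>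
    by (intro is_limit_of_rank_le_imp_flattening_minor_eq_0) auto
  ultimately show False by simp
qed

section \<open>Symmetric products\<close>

definition scale_vec :: "complex \<Rightarrow> ('i \<Rightarrow> complex) \<Rightarrow> 'i \<Rightarrow> complex" (infixr "*\<^sub>C" 75) where
  "c *\<^sub>C u = (\<lambda>i. c * u i)"

lemma vec_space_add: "u \<in> vec_space I \<Longrightarrow> v \<in> vec_space I \<Longrightarrow> u + v \<in> vec_space I"
  and vec_space_diff: "u \<in> vec_space I \<Longrightarrow> v \<in> vec_space I \<Longrightarrow> u - v \<in> vec_space I"
  and vec_space_scale: "u \<in> vec_space I \<Longrightarrow> c *\<^sub>C u \<in> vec_space I"
  and vec_space_zero: "0 \<in> vec_space I"
  and vec_space_basis_vec: "i \<in> I \<Longrightarrow> basis_vec i \<in> vec_space I"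
  by (auto simp: vec_space_def scale_vec_def basis_vec_def)

lemmas vec_space_intros =
  vec_space_add vec_space_diff vec_space_scale vec_space_zero vec_space_basis_vec

lemmas sym_prod_defs = sym_prod_def tensor_prod_def scale_vec_def

lemma isCont_sym_prod_scale:
  "isCont f s \<Longrightarrow> isCont (\<lambda>t. sym_prod u v (f t *\<^sub>C w) x y z) s"
  unfolding sym_prod_defs by (intro continuous_intros)

lemma sym_prod_zero_right: "sym_prod u v 0 = 0"
  and sym_prod_add_right: "sym_prod u v (w + w') = sym_prod u v w + sym_prod u v w'"
  and sym_prod_scale_zero: "sym_prod u v (0 *\<^sub>C w) = 0"
  by (auto simp: fun_eq_iff sym_prod_defs algebra_simps)

lemma is_sum_of_products_cube:
  assumes "u \<in> vec_space I"
  shows "is_sum_of_products I (sym_prod u u (c *\<^sub>C u)) 1"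
proof -
  have "sym_prod u u (c *\<^sub>C u) = tensor_prod u u (c *\<^sub>C u)"
    by (simp add: fun_eq_iff sym_prod_defs)
  then show ?thesis
    using assms by (simp add: is_sum_of_products_tensor_prod vec_space_scale del: One_nat_def)
qed

section \<open>Border rank modulo tangent spaces\<close>

definition border_rank_le_mod :: "'i set \<Rightarrow> 'i tensor3 set \<Rightarrow> 'i tensor3 \<Rightarrow> nat \<Rightarrow> bool" where
  "border_rank_le_mod I W T r \<longleftrightarrow> (\<forall>w\<in>W. is_limit_of_rank_le I (T + w) r)"

definition absorbs_tangents :: "'i set \<Rightarrow> 'i tensor3 set \<Rightarrow> ('i \<Rightarrow> complex) \<Rightarrow> bool" where
  "absorbs_tangents I W q \<longleftrightarrow> (\<forall>w\<in>W. \<forall>v\<in>vec_space I. w + sym_prod q q v \<in> W)"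

lemma absorbs_tangents_scale:
  assumes "absorbs_tangents I W q"
  shows "absorbs_tangents I W (c *\<^sub>C q)"
proof -
  have "sym_prod (c *\<^sub>C q) (c *\<^sub>C q) v = sym_prod q q (c\<^sup>2 *\<^sub>C v)" for v
    by (simp add: fun_eq_iff sym_prod_defs power2_eq_square algebra_simps)
  then show ?thesis
    using assms by (simp add: absorbs_tangents_def vec_space_scale)
qed

lemma border_rank_le_mod_curve:
  fixes C :: "complex \<Rightarrow> 'i tensor3"
  assumes "finite I" "\<And>t. t \<noteq> 0 \<Longrightarrow> border_rank_le_mod I W (C t) r"
    and "\<And>x y z. isCont (\<lambda>t. C t x y z) 0"
  shows "border_rank_le_mod I W (C 0) r"
  unfolding border_rank_le_mod_def
proof
  fix w assume "w \<in> W"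
  show "is_limit_of_rank_le I (C 0 + w) r"
    by (rule is_limit_of_rank_le_curve[where C = "\<lambda>t. C t + w"])
      (use assms \<open>w \<in> W\<close> in \<open>auto simp: border_rank_le_mod_def\<close>)
qed

lemma cube_second_order_expansion:
  assumes "t \<noteq> 0"
  shows "sym_prod q q ((- 1 / (3 * t\<^sup>2)) *\<^sub>C q - (1 / t) *\<^sub>C l)
      + sym_prod (q + t *\<^sub>C l) (q + t *\<^sub>C l) ((1 / (3 * t\<^sup>2)) *\<^sub>C (q + t *\<^sub>C l))
    = sym_prod l l q + sym_prod l l ((t / 3) *\<^sub>C l)"
  using assms by (simp add: fun_eq_iff sym_prod_defs field_simps power2_eq_square)

lemma border_rank_le_mod_add_square:
  assumes "finite I" "q \<in> vec_space I" "l \<in> vec_space I"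
    and W: "absorbs_tangents I W q" and T: "border_rank_le_mod I W T r"
  shows "border_rank_le_mod I W (T + sym_prod l l q) (r + 1)"
proof -
  define C where "C t = T + (sym_prod l l q + sym_prod l l ((t / 3) *\<^sub>C l))" for t
  have "border_rank_le_mod I W (C t) (r + 1)" if "t \<noteq> 0" for t
    unfolding border_rank_le_mod_def
  proof
    fix w assume "w \<in> W"
    let ?p = "q + t *\<^sub>C l" and ?v = "(- 1 / (3 * t\<^sup>2)) *\<^sub>C q - (1 / t) *\<^sub>C l"
    have "w + sym_prod q q ?v \<in> W"
      using W \<open>w \<in> W\<close> assms(2,3) by (simp add: absorbs_tangents_def vec_space_intros)
    then have "is_limit_of_rank_le I (T + (w + sym_prod q q ?v)) r"
      using T by (simp add: border_rank_le_mod_def)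
    moreover have "is_limit_of_rank_le I (sym_prod ?p ?p ((1 / (3 * t\<^sup>2)) *\<^sub>C ?p)) 1"
      using assms
      by (intro is_limit_of_rank_le_if_is_sum_of_products is_sum_of_products_cube vec_space_intros)
    ultimately have "is_limit_of_rank_le I
        ((T + (w + sym_prod q q ?v)) + sym_prod ?p ?p ((1 / (3 * t\<^sup>2)) *\<^sub>C ?p)) (r + 1)"
      by (rule is_limit_of_rank_le_add[OF \<open>finite I\<close>])
    also have "(T + (w + sym_prod q q ?v)) + sym_prod ?p ?p ((1 / (3 * t\<^sup>2)) *\<^sub>C ?p) = C t + w"
      unfolding C_def cube_second_order_expansion[OF that, symmetric] by (simp only: ac_simps)
    finally show "is_limit_of_rank_le I (C t + w) (r + 1)" .
  qed
  moreover have "isCont (\<lambda>t. C t x y z) 0" for x y z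
    unfolding C_def plus_fun_apply by (intro continuous_intros isCont_sym_prod_scale) simp
  ultimately have "border_rank_le_mod I W (C 0) (r + 1)"
    by (rule border_rank_le_mod_curve[OF \<open>finite I\<close>])
  then show ?thesis
    by (simp add: C_def sym_prod_scale_zero)
qed

definition pencil :: "('i \<Rightarrow> complex) \<Rightarrow> ('i \<Rightarrow> complex) \<Rightarrow> ('i \<Rightarrow> complex)
    \<Rightarrow> ('i \<Rightarrow> complex) \<Rightarrow> ('i \<Rightarrow> complex) \<Rightarrow> 'i tensor3" where
  "pencil a b x y z = sym_prod a x y + sym_prod b x z"

lemma pencil_diagonalisation:
  assumes "t \<noteq> 0"
  shows "sym_prod x x ((- 1 / t) *\<^sub>C a)
      + sym_prod (x + (t / 2) *\<^sub>C (y + z)) (x + (t / 2) *\<^sub>C (y + z)) ((1 / (2 * t)) *\<^sub>C (a + b))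
      + sym_prod (x + (t / 2) *\<^sub>C (y - z)) (x + (t / 2) *\<^sub>C (y - z)) ((1 / (2 * t)) *\<^sub>C (a - b))
    = pencil a b x y z + (sym_prod (y + z) (y + z) ((t / 8) *\<^sub>C (a + b))
      + sym_prod (y - z) (y - z) ((t / 8) *\<^sub>C (a - b)))"
  using assms by (simp add: fun_eq_iff pencil_def sym_prod_defs field_simps)

lemma border_rank_le_mod_add_pencil:
  assumes "finite I" "a \<in> vec_space I" "b \<in> vec_space I"
    and "x \<in> vec_space I" "y \<in> vec_space I" "z \<in> vec_space I"
    and "absorbs_tangents I W a" "absorbs_tangents I W (a + b)" "absorbs_tangents I W (a - b)"
    and "border_rank_le_mod I W T r"
  shows "border_rank_le_mod I W (T + pencil a b x y z) (r + 3)"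
proof -
  define C where "C t = T + (pencil a b x y z + (sym_prod (y + z) (y + z) ((t / 8) *\<^sub>C (a + b))
    + sym_prod (y - z) (y - z) ((t / 8) *\<^sub>C (a - b))))" for t
  have "border_rank_le_mod I W (C t) (r + 3)" if "t \<noteq> 0" for t
  proof -
    let ?l = "x + (t / 2) *\<^sub>C (y + z)" and ?l' = "x + (t / 2) *\<^sub>C (y - z)"
    have "border_rank_le_mod I W (T + sym_prod x x ((- 1 / t) *\<^sub>C a)
        + sym_prod ?l ?l ((1 / (2 * t)) *\<^sub>C (a + b))
        + sym_prod ?l' ?l' ((1 / (2 * t)) *\<^sub>C (a - b))) (r + 1 + 1 + 1)"
      by (intro border_rank_le_mod_add_square absorbs_tangents_scale vec_space_intros assms)
    then show ?thesis
      unfolding C_def pencil_diagonalisation[OF that, symmetric]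
      by (simp add: add.assoc numeral_3_eq_3)
  qed
  moreover have "isCont (\<lambda>t. C t i j k) 0" for i j k
    unfolding C_def plus_fun_apply by (intro continuous_intros isCont_sym_prod_scale) simp_all
  ultimately have "border_rank_le_mod I W (C 0) (r + 3)"
    by (rule border_rank_le_mod_curve[OF \<open>finite I\<close>])
  then show ?thesis
    by (simp add: C_def sym_prod_scale_zero)
qed

lemma border_rank_le_mod_add_pencils:
  assumes "finite I" "a \<in> vec_space I" "b \<in> vec_space I"
    and "\<And>j. j \<in> J \<Longrightarrow> x j \<in> vec_space I \<and> y j \<in> vec_space I \<and> z j \<in> vec_space I"
    and "absorbs_tangents I W a" "absorbs_tangents I W (a + b)" "absorbs_tangents I W (a - b)"
    and "border_rank_le_mod I W T r" and "finite J"
  shows "border_rank_le_mod I W (T + (\<Sum>j\<in>J. pencil a b (x j) (y j) (z j))) (r + 3 * card J)"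
  using \<open>finite J\<close> assms(4)
proof (induction J rule: finite_induct)
  case empty
  then show ?case using assms by simp
next
  case (insert j J)
  let ?P = "\<lambda>j. pencil a b (x j) (y j) (z j)"
  have "border_rank_le_mod I W (T + (\<Sum>j\<in>J. ?P j)) (r + 3 * card J)"
    using insert by blast
  then have "border_rank_le_mod I W (T + (\<Sum>j\<in>J. ?P j) + ?P j) (r + 3 * card J + 3)"
    using insert.prems by (intro border_rank_le_mod_add_pencil assms) auto
  moreover have "T + (\<Sum>j\<in>insert j J. ?P j) = T + (\<Sum>j\<in>J. ?P j) + ?P j"
    by (simp only: sum.insert[OF insert.hyps] ac_simps)
  moreover have "r + 3 * card (insert j J) = r + 3 * card J + 3"
    using insert.hyps by simp
  ultimately show ?case
    by (simp only:)
qed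

section \<open>Tangents at points with dependent cubes\<close>

definition tangent_sums :: "'i set \<Rightarrow> 'k set \<Rightarrow> ('k \<Rightarrow> 'i \<Rightarrow> complex) \<Rightarrow> 'i tensor3 set" where
  "tangent_sums I K q =
    {\<Sum>k\<in>K. sym_prod (q k) (q k) (e k) | e. \<forall>k\<in>K. e k \<in> vec_space I}"

lemma zero_in_tangent_sums: "0 \<in> tangent_sums I K q"
  unfolding tangent_sums_def
  by (intro CollectI exI[of _ "\<lambda>_. 0"]) (simp add: sym_prod_zero_right vec_space_zero)

lemma absorbs_tangents_tangent_sums:
  assumes "finite K" "k \<in> K"
  shows "absorbs_tangents I (tangent_sums I K q) (q k)"
  unfolding absorbs_tangents_def
proof (intro ballI)
  fix w v assume "w \<in> tangent_sums I K q" and v: "v \<in> vec_space I"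
  then obtain e where e: "\<forall>k\<in>K. e k \<in> vec_space I" and w: "w = (\<Sum>k\<in>K. sym_prod (q k) (q k) (e k))"
    by (auto simp: tangent_sums_def)
  have "(\<Sum>j\<in>K. sym_prod (q j) (q j) (if j = k then v else 0)) = sym_prod (q k) (q k) v"
    using assms by (simp add: if_distrib[of "sym_prod _ _"] sym_prod_zero_right cong: if_cong)
  then have "w + sym_prod (q k) (q k) v
      = (\<Sum>j\<in>K. sym_prod (q j) (q j) (e j + (if j = k then v else 0)))"
    by (simp add: w sym_prod_add_right sum.distrib)
  moreover have "\<forall>j\<in>K. e j + (if j = k then v else 0) \<in> vec_space I"
    using e v by (auto intro: vec_space_intros)
  ultimately show "w + sym_prod (q k) (q k) v \<in> tangent_sums I K q"
    unfolding tangent_sums_def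
    by (intro CollectI exI[of _ "\<lambda>j. e j + (if j = k then v else 0)"]) blast
qed

lemma cube_tangent_expansion:
  fixes q e :: "'i \<Rightarrow> complex"
  assumes "c \<noteq> 0" "t \<noteq> 0"
  defines "p \<equiv> q + (t / (3 * c)) *\<^sub>C e"
  shows "sym_prod p p ((c / t) *\<^sub>C p) = sym_prod q q ((c / t) *\<^sub>C q) + sym_prod q q e
    + sym_prod q e ((t / (3 * c)) *\<^sub>C e) + sym_prod e e ((t\<^sup>2 / (27 * c\<^sup>2)) *\<^sub>C e)"
  using assms(1,2) unfolding p_def
  by (simp add: fun_eq_iff sym_prod_defs field_simps power2_eq_square)

lemma border_rank_le_mod_tangents_at_dependent_cubes:
  fixes c :: "'k \<Rightarrow> complex"
  assumes "finite I" "\<And>k. k \<in> K \<Longrightarrow> q k \<in> vec_space I" "\<And>k. k \<in> K \<Longrightarrow> c k \<noteq> 0"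
    and dependent: "\<And>x y z. (\<Sum>k\<in>K. c k * sym_prod (q k) (q k) (q k) x y z) = 0"
  shows "border_rank_le_mod I (tangent_sums I K q) 0 (card K)"
  unfolding border_rank_le_mod_def
proof
  fix w assume "w \<in> tangent_sums I K q"
  then obtain e where e: "\<forall>k\<in>K. e k \<in> vec_space I" and w: "w = (\<Sum>k\<in>K. sym_prod (q k) (q k) (e k))"
    by (auto simp: tangent_sums_def)
  define C where "C t = (\<Sum>k\<in>K. sym_prod (q k) (q k) (e k)
    + sym_prod (q k) (e k) ((t / (3 * c k)) *\<^sub>C e k)
    + sym_prod (e k) (e k) ((t\<^sup>2 / (27 * (c k)\<^sup>2)) *\<^sub>C e k))" for t
  have "is_limit_of_rank_le I (C t) (card K)" if "t \<noteq> 0" for t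
  proof -
    let ?p = "\<lambda>k. q k + (t / (3 * c k)) *\<^sub>C e k"
    have "(\<Sum>k\<in>K. sym_prod (q k) (q k) ((c k / t) *\<^sub>C q k)) x y z
        = (\<Sum>k\<in>K. c k * sym_prod (q k) (q k) (q k) x y z) / t" for x y z
      unfolding sum_fun_apply sum_divide_distrib
      by (intro sum.cong) (simp_all add: sym_prod_defs algebra_simps)
    then have "(\<Sum>k\<in>K. sym_prod (q k) (q k) ((c k / t) *\<^sub>C q k)) = 0"
      by (simp add: fun_eq_iff dependent)
    then have "(\<Sum>k\<in>K. sym_prod (?p k) (?p k) ((c k / t) *\<^sub>C ?p k)) = C t"
      using assms(3) that by (simp add: C_def cube_tangent_expansion sum.distrib add.assoc)
    moreover have "is_sum_of_products I
        (\<Sum>k\<in>K. sym_prod (?p k) (?p k) ((c k / t) *\<^sub>C ?p k)) (\<Sum>k\<in>K. 1)"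
      using assms(2) e
      by (intro is_sum_of_products_sum is_sum_of_products_cube vec_space_intros) auto
    ultimately show ?thesis
      using \<open>finite I\<close> by (simp add: is_limit_of_rank_le_if_is_sum_of_products)
  qed
  moreover have "isCont (\<lambda>t. C t x y z) 0" for x y z
    unfolding C_def sum_fun_apply plus_fun_apply
    by (intro continuous_intros isCont_sym_prod_scale) (use assms(3) in auto)
  ultimately have "is_limit_of_rank_le I (C 0) (card K)"
    by (rule is_limit_of_rank_le_curve[OF \<open>finite I\<close>])
  then show "is_limit_of_rank_le I (0 + w) (card K)"
    by (simp add: C_def w sym_prod_scale_zero)
qed

lemma fourth_difference_of_cubes:
  fixes a b :: "'i \<Rightarrow> complex"
  defines "q \<equiv> \<lambda>n. a + (of_nat n - 2) *\<^sub>C b"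
  shows "(\<Sum>n\<le>4. (- 1) ^ n * of_nat (4 choose n) * sym_prod (q n) (q n) (q n) x y z) = 0"
  unfolding q_def by (simp add: eval_nat_numeral sym_prod_defs algebra_simps)

lemma three_collinear_tangents_border_rank_le_5:
  assumes "finite I" "a \<in> vec_space I" "b \<in> vec_space I"
  obtains W where "0 \<in> W" "absorbs_tangents I W a" "absorbs_tangents I W (a + b)"
    "absorbs_tangents I W (a - b)" "border_rank_le_mod I W 0 5"
proof
  define q :: "nat \<Rightarrow> 'a \<Rightarrow> complex" where "q = (\<lambda>n. a + (of_nat n - 2) *\<^sub>C b)"
  let ?W = "tangent_sums I {..4} q"
  have "q 2 = a" "q 3 = a + b" "q 1 = a - b"
    by (auto simp: q_def scale_vec_def fun_eq_iff)
  have "absorbs_tangents I ?W (q n)" if "n \<le> 4" for n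
    using that by (intro absorbs_tangents_tangent_sums) auto
  from this[of 2] this[of 3] this[of 1]
  show "absorbs_tangents I ?W a" "absorbs_tangents I ?W (a + b)" "absorbs_tangents I ?W (a - b)"
    by (simp_all add: \<open>q 2 = a\<close> \<open>q 3 = a + b\<close> \<open>q 1 = a - b\<close> del: One_nat_def)
  show "0 \<in> ?W"
    by (rule zero_in_tangent_sums)
  have "border_rank_le_mod I ?W 0 (card {..4::nat})"
  proof (rule border_rank_le_mod_tangents_at_dependent_cubes[OF \<open>finite I\<close>])
    show "q n \<in> vec_space I" for n
      unfolding q_def by (intro vec_space_intros assms)
    show "(\<Sum>n\<le>4. (- 1) ^ n * of_nat (4 choose n) * sym_prod (q n) (q n) (q n) x y z) = 0"
      for x y z
      unfolding q_def by (rule fourth_difference_of_cubes)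
  qed simp
  then show "border_rank_le_mod I ?W 0 5"
    by simp
qed

lemma ternary_form_as_collinear_tangents:
  "sym_prod a a (b1 - b2)
    + sym_prod (a + a') (a + a') ((1/2) *\<^sub>C b2 + (1/4) *\<^sub>C b0)
    + sym_prod (a - a') (a - a') ((1/2) *\<^sub>C b2 - (1/4) *\<^sub>C b0)
  = sym_prod a a' b0 + sym_prod a a b1 + sym_prod a' a' b2"
  by (simp add: fun_eq_iff sym_prod_defs field_simps)

lemma is_limit_of_rank_le_tangents_add_pencils:
  assumes "finite I" "finite J" and a: "a \<in> vec_space I" "a' \<in> vec_space I"
    and b: "b0 \<in> vec_space I" "b1 \<in> vec_space I" "b2 \<in> vec_space I"
    and xyz: "\<And>j. j \<in> J \<Longrightarrow> x j \<in> vec_space I \<and> y j \<in> vec_space I \<and> z j \<in> vec_space I"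
  shows "is_limit_of_rank_le I (sym_prod a a' b0 + sym_prod a a b1 + sym_prod a' a' b2
    + (\<Sum>j\<in>J. pencil a a' (x j) (y j) (z j))) (3 * card J + 5)"
proof -
  let ?pencils = "\<Sum>j\<in>J. pencil a a' (x j) (y j) (z j)"
  obtain W where "0 \<in> W" and absorbs: "absorbs_tangents I W a" "absorbs_tangents I W (a + a')"
    "absorbs_tangents I W (a - a')" and "border_rank_le_mod I W 0 5"
    by (rule three_collinear_tangents_border_rank_le_5[OF \<open>finite I\<close> a])
  then have "border_rank_le_mod I W (0 + ?pencils) (5 + 3 * card J)"
    by (intro border_rank_le_mod_add_pencils assms)
  moreover have "0 + sym_prod a a (b1 - b2)
      + sym_prod (a + a') (a + a') ((1/2) *\<^sub>C b2 + (1/4) *\<^sub>C b0)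
      + sym_prod (a - a') (a - a') ((1/2) *\<^sub>C b2 - (1/4) *\<^sub>C b0) \<in> W"
    using \<open>0 \<in> W\<close>
    by (intro absorbs[unfolded absorbs_tangents_def, rule_format] vec_space_intros b)
  then have "sym_prod a a' b0 + sym_prod a a b1 + sym_prod a' a' b2 \<in> W"
    by (simp only: ternary_form_as_collinear_tangents add_0)
  ultimately have "is_limit_of_rank_le I
      (?pencils + (sym_prod a a' b0 + sym_prod a a b1 + sym_prod a' a' b2)) (5 + 3 * card J)"
    by (simp only: border_rank_le_mod_def add_0)
  then show ?thesis
    by (simp only: ac_simps)
qed

section \<open>The tensors \<open>T_HW m\<close>\<close>

lemma T_HW_eq:
  "T_HW m = sym_prod (basis_vec A1) (basis_vec A2) (6 *\<^sub>C basis_vec B0)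
    + sym_prod (basis_vec A1) (basis_vec A1) (3 *\<^sub>C basis_vec B1)
    + sym_prod (basis_vec A2) (basis_vec A2) (3 *\<^sub>C basis_vec B2)
    + (\<Sum>j=1..m. pencil (basis_vec A1) (basis_vec A2)
        (basis_vec (Xj j)) (6 *\<^sub>C basis_vec (Yj j)) (6 *\<^sub>C basis_vec (Zj j)))"
proof -
  have "sym_prod u v (c *\<^sub>C w) x y z = c * sym_prod u v w x y z"
    for u v w :: "hw_label \<Rightarrow> complex" and c x y z
    by (simp add: sym_prod_defs algebra_simps)
  then show ?thesis
    by (simp add: fun_eq_iff T_HW_def Let_def pencil_def sum_fun_apply sum_distrib_left
        distrib_left)
qed

lemma T_HW_limit_of_rank_le: "is_limit_of_rank_le (hw_basis m) (T_HW m) (3 * m + 5)"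
proof -
  have "is_limit_of_rank_le (hw_basis m) (T_HW m) (3 * card {1..m} + 5)"
    unfolding T_HW_eq
    by (intro is_limit_of_rank_le_tangents_add_pencils conjI vec_space_intros finite_hw_basis
        finite_atLeastAtMost) (auto simp: hw_basis_def)
  then show ?thesis by simp
qed

fun isolating_pair :: "hw_label \<Rightarrow> hw_label \<times> hw_label" where
  "isolating_pair A1 = (A2, B0)"
| "isolating_pair A2 = (A1, B0)"
| "isolating_pair (Xj n) = (A1, Yj n)"
| "isolating_pair (Yj n) = (A1, Xj n)"
| "isolating_pair (Zj n) = (A2, Xj n)"
| "isolating_pair B0 = (A1, A2)"
| "isolating_pair B1 = (A1, A1)"
| "isolating_pair B2 = (A2, A2)"

lemma flattening_T_HW_isolating_pair:
  assumes "p \<in> hw_basis m"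
  shows "flattening (T_HW m) i (isolating_pair p) = of_bool (i = p)"
proof -
  note sym_prod_entry = sym_prod_defs basis_vec_def
  let ?P = "\<lambda>n. pencil (basis_vec A1) (basis_vec A2)
    (basis_vec (Xj n)) (6 *\<^sub>C basis_vec (Yj n)) (6 *\<^sub>C basis_vec (Zj n))"
  have pencil_entry:
    "?P n' i A1 (Yj n) = (if n' = n then of_bool (i = Xj n) else 0)"
    "?P n' i A1 (Xj n) = (if n' = n then of_bool (i = Yj n) else 0)"
    "?P n' i A2 (Xj n) = (if n' = n then of_bool (i = Zj n) else 0)"
    "?P n' i A1 A1 = 0" "?P n' i A1 A2 = 0" "?P n' i A2 A2 = 0"
    "?P n' i A1 B0 = 0" "?P n' i A2 B0 = 0" for n n'
    by (cases i; simp add: pencil_def sym_prod_entry)+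
  show ?thesis
    using assms unfolding T_HW_eq flattening_def plus_fun_apply sum_fun_apply
    by (cases p; simp only: isolating_pair.simps case_prod_conv pencil_entry sum.delta
        finite_atLeastAtMost sum.neutral_const;
        cases i; simp add: hw_basis_def sym_prod_entry image_iff)
qed

theorem theorem3p2:
  fixes m :: nat
  shows "border_rank (hw_basis m) (T_HW m) = 3 * m + 5"
  unfolding border_rank_def
proof (rule Least_equality)
  show "is_limit_of_rank_le (hw_basis m) (T_HW m) (3 * m + 5)"
    by (rule T_HW_limit_of_rank_le)
next
  fix r assume "is_limit_of_rank_le (hw_basis m) (T_HW m) r"
  then have "card (hw_basis m) \<le> r"
    by (rule card_le_if_flattening_contains_identity[OF finite_hw_basis])
      (rule flattening_T_HW_isolating_pair)
  then show "3 * m + 5 \<le> r" by (simp add: card_hw_basis)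
qed

end
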